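(* Let the inputs $X_t$ be strictly stationary, temperately dependent, satisfy the Glivenko-Cantelli property, and have finite $p$-th moments $\mathbb{E}(|X_t|^p)<\infty$ for some $p>2$. Let the cdf $F$ and its quantile function $F^{-1}$ be continuous. Assume that the baseline function $h_0$ is absolutely continuous on $[a_X,b_X]$ and such that its Radon-Nikodym derivative $h_0^*$ is continuous on a finite interval $[a,b]\subseteq[a_X,b_X]$ and vanishes outside $[a,b]$, with $\int_a^b|h_0^*(x)|\,\mathrm{d}x>0$. Then, when $n\to\infty$, $$I^0_n:=\frac{\sum_{i=2}^n(Y^0_{i,n}-Y^0_{i-1,n})_+}{\sum_{i=2}^n|Y^0_{i,n}-Y^0_{i-1,n}|}\;\to_{\mathbb{P}}\; I^0_\infty:=\frac{\int_a^b(h_0^*(x))_+\,\mathrm{d}x}{\int_a^b|h_0^*(x)|\,\mathrm{d}x}.$$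
   Context: The inputs $(X_t)_{t\in\mathbb{Z}}$ are real-valued random variables with the same continuous marginal cdf $F$, assumed (almost surely) pairwise distinct, so the order statistics of $X_1,\dots,X_n$ satisfy $X_{1:n}<\cdots<X_{n:n}$. Endpoints of the support: $a_X=\sup\{x\in\mathbb{R}:F(x)=0\}$ and $b_X=\inf\{x\in\mathbb{R}:F(x)=1\}$, possibly infinite; $[a_X,b_X]$ is understood as its intersection with $\mathbb{R}$. The quantile function is $F^{-1}(u)=\inf\{x:F(x)\ge u\}$, $u\in(0,1)$. The inputs are temperately dependent if, for every $x\in(a_X,b_X)$, $\mathbb{P}(X_{1:n}\ge x)\to 0$ and $\mathbb{P}(X_{n:n}\le x)\to 0$ when $n\to\infty$. They satisfy the Glivenko-Cantelli property if $\sup_{x\in\mathbb{R}}|F_n(x)-F(x)|\to_{\mathbb{P}}0$, where $F_n$ is the empirical cdf of $X_1,\dots,X_n$. The baseline function is $h_0:\mathbb{R}\to\mathbb{R}$; the anomaly-free outputs are $Y^0_t=h_0(X_t)$, with concomitants $Y^0_{t,n}=\sum_{s=1}^n Y^0_s\mathbf{1}\{X_s=X_{t:n}\}$, $t=1,\dots,n$. $h_0$ is absolutely continuous on $[a_X,b_X]$ if there is a function $h_0^*$ (its Radon-Nikodym derivative) with $h_0(v)-h_0(u)=\int_u^v h_0^*(x)\,\mathrm{d}x$ for all $u\le v$ in $[a_X,b_X]$. $z_+=\max(z,0)$. On the event that the denominator of $I^0_n$ is zero, $I^0_n$ may be given any fixed value. $\to_{\mathbb{P}}$ denotes convergence in probability.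 *)

theory Defs
  imports "HOL-Probability.Probability"
begin

definition strictly_stationary :: "'a measure \<Rightarrow> (int \<Rightarrow> 'a \<Rightarrow> real) \<Rightarrow> bool" where
  "strictly_stationary M X \<longleftrightarrow>
     (\<forall>J k. finite J \<longrightarrow>
        distr M (\<Pi>\<^sub>M t\<in>J. borel) (\<lambda>\<omega>. \<lambda>t\<in>J. X (t + k) \<omega>) =
        distr M (\<Pi>\<^sub>M t\<in>J. borel) (\<lambda>\<omega>. \<lambda>t\<in>J. X t \<omega>))"

definition tendsto_in_prob :: "'a measure \<Rightarrow> (nat \<Rightarrow> 'a \<Rightarrow> real) \<Rightarrow> real \<Rightarrow> bool" where
  "tendsto_in_prob M Z z \<longleftrightarrow>
     (\<forall>\<epsilon>>0. (\<lambda>n. \<P>(\<omega> in M. \<bar>Z n \<omega> - z\<bar> > \<epsilon>)) \<longlonglongrightarrow> 0)"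

text \<open>The endpoints of the support are extended reals: the supremum of the empty set is
  \<open>-\<infinity>\<close> and its infimum is \<open>\<infinity>\<close>.\<close>

definition lower_endpoint :: "(real \<Rightarrow> real) \<Rightarrow> ereal" where
  "lower_endpoint F = Sup (ereal ` {x. F x = 0})"

definition upper_endpoint :: "(real \<Rightarrow> real) \<Rightarrow> ereal" where
  "upper_endpoint F = Inf (ereal ` {x. F x = 1})"

definition support_interval :: "(real \<Rightarrow> real) \<Rightarrow> real set" where
  "support_interval F = {x. lower_endpoint F \<le> ereal x \<and> ereal x \<le> upper_endpoint F}"

text \<open>Meaningful for \<open>u\<close> in \<open>{0<..<1}\<close> only, where the set is nonempty and bounded below.\<close>

definition quantile :: "(real \<Rightarrow> real) \<Rightarrow> real \<Rightarrow> real" where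
  "quantile F u = Inf {x. u \<le> F x}"

text \<open>The order statistic \<open>X\<^bsub>i:n\<^esub>\<close> of \<open>X\<^sub>1, \<dots>, X\<^sub>n\<close>, for \<open>1 \<le> i \<le> n\<close>;
  list positions start from 0.\<close>

definition order_stat :: "(int \<Rightarrow> 'a \<Rightarrow> real) \<Rightarrow> nat \<Rightarrow> nat \<Rightarrow> 'a \<Rightarrow> real" where
  "order_stat X i n \<omega> = sort (map (\<lambda>t. X (int t) \<omega>) [1..<Suc n]) ! (i - 1)"

definition empirical_cdf :: "(int \<Rightarrow> 'a \<Rightarrow> real) \<Rightarrow> nat \<Rightarrow> 'a \<Rightarrow> real \<Rightarrow> real" where
  "empirical_cdf X n \<omega> x = real (card {t \<in> {1..n}. X (int t) \<omega> \<le> x}) / real n"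

definition temperately_dependent ::
    "'a measure \<Rightarrow> (int \<Rightarrow> 'a \<Rightarrow> real) \<Rightarrow> (real \<Rightarrow> real) \<Rightarrow> bool" where
  "temperately_dependent M X F \<longleftrightarrow>
     (\<forall>x. lower_endpoint F < ereal x \<and> ereal x < upper_endpoint F \<longrightarrow>
        (\<lambda>n. \<P>(\<omega> in M. order_stat X 1 n \<omega> \<ge> x)) \<longlonglongrightarrow> 0 \<and>
        (\<lambda>n. \<P>(\<omega> in M. order_stat X n n \<omega> \<le> x)) \<longlonglongrightarrow> 0)"

definition glivenko_cantelli ::
    "'a measure \<Rightarrow> (int \<Rightarrow> 'a \<Rightarrow> real) \<Rightarrow> (real \<Rightarrow> real) \<Rightarrow> bool" where
  "glivenko_cantelli M X F \<longleftrightarrow>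
     tendsto_in_prob M (\<lambda>n \<omega>. SUP x. \<bar>empirical_cdf X n \<omega> x - F x\<bar>) 0"

text \<open>\<open>h\<close> is absolutely continuous on the interval \<open>S\<close> with Radon-Nikodym derivative \<open>g\<close>.
  Integrability is required explicitly because non-integrable functions have integral 0 in HOL.\<close>

definition absolutely_continuous_with_deriv ::
    "(real \<Rightarrow> real) \<Rightarrow> (real \<Rightarrow> real) \<Rightarrow> real set \<Rightarrow> bool" where
  "absolutely_continuous_with_deriv h g S \<longleftrightarrow>
     (\<forall>u\<in>S. \<forall>v\<in>S. u \<le> v \<longrightarrow>
        set_integrable lborel {u..v} g \<and> h v - h u = (LINT x:{u..v}|lborel. g x))"

definition baseline_output :: "(real \<Rightarrow> real) \<Rightarrow> (int \<Rightarrow> 'a \<Rightarrow> real) \<Rightarrow> int \<Rightarrow> 'a \<Rightarrow> real" where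
  "baseline_output h\<^sub>0 X t \<omega> = h\<^sub>0 (X t \<omega>)"

definition concomitant ::
    "(int \<Rightarrow> 'a \<Rightarrow> real) \<Rightarrow> (int \<Rightarrow> 'a \<Rightarrow> real) \<Rightarrow> nat \<Rightarrow> nat \<Rightarrow> 'a \<Rightarrow> real" where
  "concomitant X Y i n \<omega> =
     (\<Sum>s=1..n. Y (int s) \<omega> * of_bool (X (int s) \<omega> = order_stat X i n \<omega>))"

text \<open>The index takes the fixed value \<open>c\<close> where its denominator is zero.\<close>

definition I_index ::
    "real \<Rightarrow> (int \<Rightarrow> 'a \<Rightarrow> real) \<Rightarrow> (int \<Rightarrow> 'a \<Rightarrow> real) \<Rightarrow> nat \<Rightarrow> 'a \<Rightarrow> real" where
  "I_index c X Y n \<omega> =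
     (let num = (\<Sum>i=2..n. max (concomitant X Y i n \<omega> - concomitant X Y (i - 1) n \<omega>) 0);
          den = (\<Sum>i=2..n. \<bar>concomitant X Y i n \<omega> - concomitant X Y (i - 1) n \<omega>\<bar>)
      in if den = 0 then c else num / den)"

end

theory Submission
  imports Defs
begin

text \<open>The continuity of \<open>F\<^sup>-\<^sup>1\<close> makes \<open>F\<close> strictly increasing on its support, so by the
  Glivenko-Cantelli property every cell of a fixed partition of \<open>[a, b]\<close> contains an input with
  probability tending to one. As \<open>h\<^sub>0\<close> is constant on either side of \<open>[a, b]\<close>, the increments of
  the concomitants are those of \<open>h\<^sub>0\<close> over a fine partition of \<open>[a, b]\<close>, and by the mean value
  theorem and the uniform continuity of \<open>h\<^sub>0\<^sup>*\<close> the numerator and the denominator are close to their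
  integrals.\<close>

section \<open>Sums of increments over fine partitions\<close>

text \<open>The mean value theorem is applied to \<open>integral {u..x} f\<close> as a function of
  \<open>x\<close>; the case \<open>u = v\<close> is separate since \<open>mvt\<close> needs a
  strict inequality.\<close>

lemma integral_mean_value:
  fixes f :: "real \<Rightarrow> real"
  assumes "u \<le> v" "continuous_on {u..v} f"
  obtains s where "s \<in> {u..v}" "(LINT x:{u..v}|lborel. f x) = f s * (v - u)"
proof (cases "u = v")
  case True
  have "(LINT x:{u..v}|lborel. f x) = integral {u..v} f"
    using set_borel_integral_eq_integral(2) borel_integrable_atLeastAtMost' assms(2) by blast
  with True show ?thesis by (intro that[of u]) auto
next
  case False
  let ?I = "\<lambda>x. integral {u..x} f"
  have deriv: "(?I has_real_derivative f t) (at t within {u..v})" if "t \<in> {u..v}" for t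
    using integral_has_real_derivative[OF assms(2) that] .
  have "continuous_on {u..v} ?I"
    using deriv DERIV_continuous_on by blast
  moreover have "(?I has_derivative (*) (f t)) (at t)" if "u < t" "t < v" for t
    using deriv[of t] that at_within_Icc_at[of u t v] by (simp add: has_field_derivative_def)
  moreover have "u < v" using assms(1) False by simp
  ultimately obtain s where s: "u < s" "s < v" "?I v - ?I u = f s * (v - u)"
    using mvt[of u v ?I "\<lambda>t. (*) (f t)"] by metis
  have "(LINT x:{u..v}|lborel. f x) = ?I v"
    using set_borel_integral_eq_integral(2) borel_integrable_atLeastAtMost' assms(2) by blast
  with s show ?thesis by (intro that[of s]) auto
qed

text \<open>For \<open>a \<le> b\<close> this is the projection onto \<open>{a..b}\<close>. It
  absorbs the inputs outside the interval, where the baseline function is constant on either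
  side.\<close>

abbreviation clamp_Icc :: "real \<Rightarrow> real \<Rightarrow> real \<Rightarrow> real" where
  "clamp_Icc a b x \<equiv> max a (min b x)"

text \<open>A gap longer than \<open>2 * \<delta>\<close> would contain a whole grid cell, and the
  point hitting that cell would lie strictly between two consecutive values of a monotone
  sequence.\<close>

lemma clamp_gap_le:
  fixes y :: "nat \<Rightarrow> real" and a \<delta> :: real and m n :: nat
  defines "b \<equiv> a + m * \<delta>"
  assumes "\<delta> > 0" and mono: "mono_on {1..n} y"
    and hit: "\<And>j. j < m \<Longrightarrow> \<exists>i\<in>{1..n}. a + j * \<delta> < y i \<and> y i \<le> a + Suc j * \<delta>"
    and "1 \<le> i" "Suc i \<le> n"
  shows "clamp_Icc a b (y (Suc i)) - clamp_Icc a b (y i) \<le> 2 * \<delta>"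
proof (rule ccontr)
  let ?u = "clamp_Icc a b (y i)" and ?v = "clamp_Icc a b (y (Suc i))"
  assume "\<not> ?v - ?u \<le> 2 * \<delta>"
  then have big: "?v > ?u + 2 * \<delta>" by simp
  have "a \<le> b" using assms(2) by (simp add: b_def)
  \<comment> \<open>The first grid point at or to the right of \<open>?u\<close>: it is less than
    \<open>\<delta>\<close> away, so its cell ends before \<open>?u + 2 * \<delta>\<close>.\<close>
  define j where "j = nat \<lceil>(?u - a) / \<delta>\<rceil>"
  have "(?u - a) / \<delta> \<ge> 0" using assms(2) by simp
  then have j: "real j \<ge> (?u - a) / \<delta>" "real j < (?u - a) / \<delta> + 1"
    unfolding j_def by linarith+
  have j1: "a + j * \<delta> \<ge> ?u" using j(1) assms(2) by (simp add: field_simps)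
  have j2: "a + Suc j * \<delta> < ?u + 2 * \<delta>" using j(2) assms(2) by (simp add: field_simps)
  have "?v \<le> b" using \<open>a \<le> b\<close> by simp
  with j2 big have lt: "real (Suc j) * \<delta> < real m * \<delta>" unfolding b_def by linarith
  then have "Suc j < m" using assms(2) by (simp only: mult_less_cancel_right_pos of_nat_less_iff)
  then obtain k where k: "k \<in> {1..n}" "a + j * \<delta> < y k" "y k \<le> a + Suc j * \<delta>"
    using hit[of j] by auto
  have "?u < y k" "y k < ?v" using k j1 j2 big by linarith+
  show False
  proof (cases "k \<le> i")
    case True
    then have "y k \<le> y i" using mono_onD[OF mono, of k i] k assms(5,6) by auto
    \<comment> \<open>Here \<open>y i\<close> exceeds its own projection, so \<open>?u = b\<close>,
      whereas \<open>?u < y k < ?v \<le> b\<close>. In the other case \<open>y (Suc i)\<close> lies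
      below its projection, so \<open>?v = a\<close>, which \<open>?v > ?u\<close> excludes.\<close>
    with \<open>?u < y k\<close> \<open>y k < ?v\<close> \<open>?v \<le> b\<close> show False by linarith
  next
    case False
    then have "y (Suc i) \<le> y k" using mono_onD[OF mono, of "Suc i" k] k assms(5,6) by auto
    with \<open>?u < y k\<close> \<open>y k < ?v\<close> show False by linarith
  qed
qed

text \<open>Taking \<open>\<psi>\<close> as the positive part or the absolute value gives the
  numerator or the denominator of the index. The threshold for \<open>m\<close> is uniform in
  \<open>n\<close> and \<open>y\<close>, so that random samples can be inserted pointwise
  later.\<close>

lemma sum_increments_approx:
  fixes f H \<psi> :: "real \<Rightarrow> real"
  assumes "a < b" and f: "continuous_on {a..b} f"
    and H: "\<And>u v. a \<le> u \<Longrightarrow> u \<le> v \<Longrightarrow> v \<le> b \<Longrightarrow> H v - H u = (LINT x:{u..v}|lborel. f x)"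
    and hom: "\<And>c x. c \<ge> 0 \<Longrightarrow> \<psi> (x * c) = \<psi> x * c"
    and lip: "\<And>x y. \<bar>\<psi> x - \<psi> y\<bar> \<le> \<bar>x - y\<bar>"
    and "e > 0"
  shows "\<forall>\<^sub>F m in sequentially. \<forall>(n::nat) (y::nat \<Rightarrow> real). mono_on {1..n} y \<longrightarrow>
      (\<forall>j<m. \<exists>i\<in>{1..n}. a + j * ((b - a) / m) < y i \<and> y i \<le> a + Suc j * ((b - a) / m)) \<longrightarrow>
      \<bar>(\<Sum>i=2..n. \<psi> (H (clamp_Icc a b (y i)) - H (clamp_Icc a b (y (i - 1)))))
        - (LINT x:{a..b}|lborel. \<psi> (f x))\<bar> \<le> e"
proof -
  \<comment> \<open>A primitive of the target integrand: the integral becomes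
    \<open>G b - G a\<close>, which can be compared gap by gap with the sum.\<close>
  define G where "G x = integral {a..x} (\<lambda>t. \<psi> (f t))" for x
  have "continuous_on UNIV \<psi>"
    by (auto simp: continuous_on_iff dist_real_def intro: le_less_trans[OF lip])
  then have \<psi>f: "continuous_on {a..b} (\<lambda>x. \<psi> (f x))"
    by (rule continuous_on_compose2[OF _ f]) auto
  have LG: "(LINT x:{a..b}|lborel. \<psi> (f x)) = G b - G a"
    unfolding G_def
    using set_borel_integral_eq_integral(2)[OF borel_integrable_atLeastAtMost'[OF \<psi>f]] by simp
  have mvH: "\<exists>s\<in>{u..v}. H v - H u = f s * (v - u)" if uv: "a \<le> u" "u \<le> v" "v \<le> b" for u v
  proof -
    have "continuous_on {u..v} f" using uv by (intro continuous_on_subset[OF f]) auto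
    then obtain s where "s \<in> {u..v}" "(LINT x:{u..v}|lborel. f x) = f s * (v - u)"
      using integral_mean_value uv(2) by blast
    with H[OF uv] show ?thesis by auto
  qed
  have mvG: "\<exists>s\<in>{u..v}. G v - G u = \<psi> (f s) * (v - u)" if uv: "a \<le> u" "u \<le> v" "v \<le> b" for u v
  proof -
    have c: "continuous_on {a..v} (\<lambda>x. \<psi> (f x))" "continuous_on {u..v} (\<lambda>x. \<psi> (f x))"
      using uv by (auto intro: continuous_on_subset[OF \<psi>f])
    have "integral {a..u} (\<lambda>x. \<psi> (f x)) + integral {u..v} (\<lambda>x. \<psi> (f x)) = G v"
      unfolding G_def using uv c
      by (intro Henstock_Kurzweil_Integration.integral_combine integrable_continuous_real) auto
    then have "G v - G u = (LINT x:{u..v}|lborel. \<psi> (f x))"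
      using set_borel_integral_eq_integral(2)[OF borel_integrable_atLeastAtMost'[OF c(2)]]
      by (simp add: G_def)
    moreover obtain s where "s \<in> {u..v}" "(LINT x:{u..v}|lborel. \<psi> (f x)) = \<psi> (f s) * (v - u)"
      using integral_mean_value[OF uv(2) c(2)] .
    ultimately show ?thesis by auto
  qed
  \<comment> \<open>The errors over the gaps add up to at most
    \<open>\<eta> * (b - a) = e / 2\<close>; this leaves \<open>e / 4\<close> for each of the two
    end pieces.\<close>
  define \<eta> where "\<eta> = e / 2 / (b - a)"
  have \<eta>: "\<eta> > 0" "\<eta> * (b - a) = e / 2"
    using assms(1,6) nonzero_eq_divide_eq[of "b - a" \<eta> "e / 2"] by (simp_all add: \<eta>_def)
  have "uniformly_continuous_on {a..b} f"
    using compact_uniformly_continuous[OF f] by simp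
  then obtain d where d: "d > 0"
    "\<And>s t. s \<in> {a..b} \<Longrightarrow> t \<in> {a..b} \<Longrightarrow> dist t s < d \<Longrightarrow> dist (f t) (f s) < \<eta>"
    unfolding uniformly_continuous_on_def using \<eta>(1) by metis
  have "bounded ((\<lambda>x. \<psi> (f x)) ` {a..b})"
    by (intro compact_imp_bounded compact_continuous_image[OF \<psi>f]) simp
  then obtain K where K: "K > 0" "\<And>x. x \<in> {a..b} \<Longrightarrow> \<bar>\<psi> (f x)\<bar> \<le> K"
    unfolding bounded_pos by (auto simp: image_iff)
  have "(\<lambda>m. (b - a) / real m) \<longlonglongrightarrow> 0"
    by (rule lim_const_over_n)
  \<comment> \<open>\<open>d / 2\<close> because gaps can be as long as two cells;
    \<open>e / (4 * K)\<close> because an end piece is at most one cell long and the slope of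
    \<open>G\<close> is bounded by \<open>K\<close>.\<close>
  moreover have "min (d / 2) (e / (4 * K)) > 0" using d(1) K(1) assms(6) by simp
  ultimately have "\<forall>\<^sub>F m in sequentially. (b - a) / real m < min (d / 2) (e / (4 * K))"
    by (rule order_tendstoD(2))
  then show ?thesis
    using eventually_gt_at_top[of 0]
  proof eventually_elim
    case (elim m)
    define \<delta> where "\<delta> = (b - a) / real m"
    have \<delta>: "\<delta> > 0" "2 * \<delta> < d" "\<delta> * K < e / 4" "b = a + m * \<delta>"
      using elim assms(1) K(1) by (auto simp: \<delta>_def field_simps)
    have main: "\<bar>(\<Sum>i=2..n. \<psi> (H (clamp_Icc a b (y i)) - H (clamp_Icc a b (y (i - 1)))))
        - (LINT x:{a..b}|lborel. \<psi> (f x))\<bar> \<le> e"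
      if mono: "mono_on {1..n} y"
        and hit: "\<forall>j<m. \<exists>i\<in>{1..n}. a + j * \<delta> < y i \<and> y i \<le> a + Suc j * \<delta>" for n :: nat and y :: "nat \<Rightarrow> real"
    proof -
      define c where "c i = clamp_Icc a b (y i)" for i
      have cab: "a \<le> c i" "c i \<le> b" for i
        using assms(1) by (auto simp: c_def)
      \<comment> \<open>Points in the first and last cells bring the projections of the smallest and
        largest values within \<open>\<delta>\<close> of \<open>a\<close> and
        \<open>b\<close>.\<close>
      obtain i0 where i0: "i0 \<in> {1..n}" "y i0 \<le> a + \<delta>"
        using hit[rule_format, of 0] elim(2) by auto
      obtain i1 where i1: "i1 \<in> {1..n}" "a + (m - 1) * \<delta> < y i1"
        using hit[rule_format, of "m - 1"] elim(2) by auto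
      have "y 1 \<le> y i0" using mono_onD[OF mono] i0 by auto
      then have c1: "c 1 - a \<le> \<delta>" using i0 \<delta>(1) unfolding c_def by linarith
      have "y i1 \<le> y n" using mono_onD[OF mono] i1 by auto
      moreover have "real (m - 1) * \<delta> = m * \<delta> - \<delta>" using elim(2) by (simp add: algebra_simps of_nat_diff)
      ultimately have cn: "b - c n \<le> \<delta>" using i1 \<delta>(1,4) unfolding c_def by linarith
      have cmono: "c (i - 1) \<le> c i" if "i \<in> {2..n}" for i
      proof -
        have "y (i - 1) \<le> y i" using that by (intro mono_onD[OF mono]) auto
        then show ?thesis unfolding c_def by linarith
      qed
      have gap: "c i - c (i - 1) \<le> 2 * \<delta>" if "i \<in> {2..n}" for i
      proof -
        have "clamp_Icc a b (y (Suc (i - 1))) - clamp_Icc a b (y (i - 1)) \<le> 2 * \<delta>"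
          unfolding \<delta>(4) using that hit by (intro clamp_gap_le[OF \<delta>(1) mono]) auto
        with that show ?thesis by (simp add: c_def)
      qed
      \<comment> \<open>The mean value points \<open>s\<close> for \<open>H\<close> and
        \<open>r\<close> for \<open>G\<close> may differ, but they share a gap shorter than
        \<open>d\<close>. Homogeneity pulls the nonnegative gap length out of
        \<open>\<psi>\<close>.\<close>
      have gap_error: "\<bar>\<psi> (H (c i) - H (c (i - 1))) - (G (c i) - G (c (i - 1)))\<bar> \<le> \<eta> * (c i - c (i - 1))"
        if i: "i \<in> {2..n}" for i
      proof -
        let ?l = "c i - c (i - 1)"
        obtain s where s: "s \<in> {c (i-1)..c i}" "H (c i) - H (c (i - 1)) = f s * ?l"
          using mvH cab cmono[OF i] by metis
        obtain r where r: "r \<in> {c (i-1)..c i}" "G (c i) - G (c (i - 1)) = \<psi> (f r) * ?l"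
          using mvG cab cmono[OF i] by metis
        have "dist s r < d" using s(1) r(1) gap[OF i] \<delta>(2) unfolding dist_real_def by auto
        moreover have "s \<in> {a..b}" "r \<in> {a..b}" 
          using s(1) r(1) cab[of i] cab[of "i - 1"] by auto
        ultimately have "\<bar>f s - f r\<bar> < \<eta>" using d(2)[of r s] by (simp add: dist_real_def)
        then have "\<bar>\<psi> (f s) - \<psi> (f r)\<bar> \<le> \<eta>" using lip[of "f s" "f r"] by linarith
        then have "\<bar>\<psi> (f s) - \<psi> (f r)\<bar> * ?l \<le> \<eta> * ?l"
          using cmono[OF i] by (intro mult_right_mono) auto
        moreover have "\<psi> (H (c i) - H (c (i - 1))) = \<psi> (f s) * ?l"
          unfolding s(2) using cmono[OF i] by (intro hom) simp
        ultimately show ?thesis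
          using r(2) cmono[OF i] by (simp add: abs_mult flip: left_diff_distrib)
      qed
      have "1 \<le> n" using i0 by auto
      have tele: "(\<Sum>i=2..n. g (c i) - g (c (i - 1))) = g (c n) - g (c 1)" for g :: "real \<Rightarrow> real"
        using sum_telescope''[OF \<open>1 \<le> n\<close>, of "\<lambda>i. g (c i)"] by (simp add: numeral_2_eq_2)
      let ?S = "\<Sum>i=2..n. \<psi> (H (c i) - H (c (i - 1)))"
      have "\<bar>?S - (G (c n) - G (c 1))\<bar>
          = \<bar>\<Sum>i=2..n. \<psi> (H (c i) - H (c (i - 1))) - (G (c i) - G (c (i - 1)))\<bar>"
        unfolding tele[of G, symmetric] by (simp only: sum_subtractf)
      also have "\<dots> \<le> (\<Sum>i=2..n. \<eta> * (c i - c (i - 1)))"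
        by (intro order_trans[OF sum_abs] sum_mono gap_error)
      also have "\<dots> = \<eta> * (c n - c 1)"
        using tele[of "\<lambda>x. x"] by (simp flip: sum_distrib_left)
      also have "\<dots> \<le> \<eta> * (b - a)"
        using \<eta>(1) cab[of n] cab[of 1] by (intro mult_left_mono) auto
      finally have A: "\<bar>?S - (G (c n) - G (c 1))\<bar> \<le> e / 2" using \<eta>(2) by simp
      have small: "\<bar>G v - G u\<bar> \<le> e / 4" if uv: "a \<le> u" "u \<le> v" "v \<le> b" "v - u \<le> \<delta>" for u v
      proof -
        obtain s where s: "s \<in> {u..v}" "G v - G u = \<psi> (f s) * (v - u)" 
          using mvG[OF uv(1-3)] by blast
        have "\<bar>\<psi> (f s)\<bar> * (v - u) \<le> K * \<delta>"
          using K(2)[of s] s(1) uv K(1) by (intro mult_mono) auto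
        then show ?thesis using s(2) uv \<delta>(3) by (simp add: abs_mult mult.commute)
      qed
      \<comment> \<open>The telescoped sum only reaches from \<open>c 1\<close> to
        \<open>c n\<close>; these are the missing end pieces.\<close>
      have "\<bar>G (c 1) - G a\<bar> \<le> e / 4" "\<bar>G b - G (c n)\<bar> \<le> e / 4"
        by (rule small; use c1 cn cab[of 1] cab[of n] in simp)+
      with A have "\<bar>?S - (G b - G a)\<bar> \<le> e" by linarith
      then show ?thesis unfolding LG c_def .
    qed
    show ?case
      using main unfolding \<delta>_def by blast
  qed
qed

section \<open>The marginal distribution and its support\<close>

text \<open>A flat stretch of \<open>F\<close> at a level in \<open>{0<..<1}\<close> is a jump of
  the quantile function. The levels 0 and 1 are excluded by the endpoints of the support.\<close>

lemma continuous_quantile_imp_less: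
  assumes "mono F" and top: "(F \<longlongrightarrow> 1) at_top" and bot: "(F \<longlongrightarrow> 0) at_bot"
    and range: "\<And>x. F x \<in> {0..1}"
    and q: "continuous_on {0<..<1} (quantile F)"
    and uv: "u \<in> support_interval F" "v \<in> support_interval F" "u < v"
  shows "F u < F v"
proof (rule ccontr)
  assume "\<not> F u < F v"
  with monoD[OF assms(1), of u v] uv(3) have eq: "F v = F u" by auto
  have "F u \<noteq> 0"
  proof
    assume "F u = 0"
    with eq have "ereal v \<le> lower_endpoint F" unfolding lower_endpoint_def by (intro Sup_upper) auto
    also have "\<dots> \<le> ereal u" using uv(1) by (simp add: support_interval_def)
    finally show False using uv(3) by simp
  qed
  moreover have "F u \<noteq> 1"
  proof
    assume "F u = 1"
    then have "upper_endpoint F \<le> ereal u" unfolding upper_endpoint_def by (intro Inf_lower) auto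
    moreover have "ereal v \<le> upper_endpoint F" using uv(2) by (simp add: support_interval_def)
    ultimately have "ereal v \<le> ereal u" by (rule order_trans[rotated])
    then show False using uv(3) by simp
  qed
  ultimately have Fu: "F u \<in> {0<..<1}" using range[of u] by auto
  \<comment> \<open>As \<open>F\<close> stays at \<open>F u\<close> up to \<open>v\<close>, no
    higher level is reached before \<open>v\<close>; the right limit of the quantile function at
    \<open>F u\<close> is therefore at least \<open>v\<close>.\<close>
  have below: "v \<le> quantile F w" if "F u < w" "w < 1" for w
    unfolding quantile_def
  proof (rule cInf_greatest)
    have "\<forall>\<^sub>F x in at_top. w < F x" using order_tendstoD(1)[OF top \<open>w < 1\<close>] .
    then have "\<exists>x. w < F x" by (auto simp: eventually_at_top_linorder)
    then show "{x. w \<le> F x} \<noteq> {}" by (auto intro: less_imp_le)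
  next
    fix x assume "x \<in> {x. w \<le> F x}"
    then have "\<not> x \<le> v" using monoD[OF assms(1), of x v] eq that(1) by auto
    then show "v \<le> x" by simp
  qed
  have "isCont (quantile F) (F u)"
    using q Fu by (simp add: continuous_on_eq_continuous_at)
  then have "(quantile F \<longlongrightarrow> quantile F (F u)) (at_right (F u))"
    unfolding isCont_def by (rule tendsto_mono[OF at_le, rotated]) simp
  moreover have "\<forall>\<^sub>F w in at_right (F u). v \<le> quantile F w"
    unfolding eventually_at_right_field using Fu below by (auto intro!: exI[of _ 1])
  ultimately have "v \<le> quantile F (F u)"
    by (intro tendsto_lowerbound) auto
  moreover have "quantile F (F u) \<le> u"
    unfolding quantile_def
  proof (rule cInf_lower)
    \<comment> \<open>The limit at \<open>at_bot\<close> bounds the set from below, as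
      \<open>cInf_lower\<close> requires.\<close>
    have "\<forall>\<^sub>F x in at_bot. F x < F u" using order_tendstoD(2)[OF bot] Fu by auto
    then obtain N where N: "F N < F u" by (auto simp: eventually_at_bot_linorder)
    show "bdd_below {x. F u \<le> F x}"
    proof (rule bdd_belowI)
      fix x assume "x \<in> {x. F u \<le> F x}"
      then have "\<not> x \<le> N" using N monoD[OF assms(1), of x N] by auto
      then show "N \<le> x" by simp
    qed
  qed simp
  ultimately show False using uv(3) by linarith
qed

text \<open>Each single threshold excludes a null event. Rational thresholds keep these events
  countable, and density with monotonicity of \<open>F\<close> recovers the real thresholds.\<close>

lemma AE_in_support_interval:
  assumes "prob_space M" "Y \<in> borel_measurable M"
  defines "F \<equiv> cdf (distr M borel Y)"
  shows "AE \<omega> in M. Y \<omega> \<in> support_interval F"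
proof -
  interpret prob_space M by fact
  interpret D: real_distribution "distr M borel Y"
    using real_distribution_distr assms(2) by simp
  have cdf: "F x = prob {\<omega> \<in> space M. Y \<omega> \<le> x}" for x
  proof -
    have "Y -` {..x} \<inter> space M = {\<omega> \<in> space M. Y \<omega> \<le> x}" by auto
    then show ?thesis using assms(2) by (simp add: F_def cdf_def measure_distr)
  qed
  have mono: "F x \<le> F y" if "x \<le> y" for x y
    unfolding F_def using that by (rule D.cdf_nondecreasing)
  have meas [measurable]: "Y \<in> borel_measurable M" by fact
  have "AE \<omega> in M. F x = 0 \<longrightarrow> \<not> Y \<omega> \<le> x" for x
    using prob_eq_0[of "{\<omega> \<in> space M. Y \<omega> \<le> x}"] by (auto simp: cdf)
  then have "AE \<omega> in M. \<forall>q::rat. F (of_rat q) = 0 \<longrightarrow> \<not> Y \<omega> \<le> of_rat q"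
    by (subst AE_all_countable) blast
  moreover have "AE \<omega> in M. F x = 1 \<longrightarrow> Y \<omega> \<le> x" for x
    using prob_eq_1[of "{\<omega> \<in> space M. Y \<omega> \<le> x}"] by (auto simp: cdf)
  then have "AE \<omega> in M. \<forall>q::rat. F (of_rat q) = 1 \<longrightarrow> Y \<omega> \<le> of_rat q"
    by (subst AE_all_countable) blast
  ultimately show ?thesis
  proof eventually_elim
    case (elim \<omega>)
    have "ereal x \<le> ereal (Y \<omega>)" if "F x = 0" for x
    proof (rule ccontr)
      assume "\<not> ereal x \<le> ereal (Y \<omega>)"
      then obtain q where q: "Y \<omega> < of_rat q" "of_rat q < x" using of_rat_dense[of "Y \<omega>" x] by auto
      with mono[of "of_rat q" x] that have "F (of_rat q) = 0" by (simp add: cdf measure_le_0_iff)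
      with elim(1) q(1) show False by (meson less_imp_le)
    qed
    moreover have "ereal (Y \<omega>) \<le> ereal x" if "F x = 1" for x
    proof (rule ccontr)
      assume "\<not> ereal (Y \<omega>) \<le> ereal x"
      then obtain q where q: "x < of_rat q" "of_rat q < Y \<omega>" using of_rat_dense[of x "Y \<omega>"] by auto
      with mono[of x "of_rat q"] that have "F (of_rat q) = 1"
        using D.cdf_bounded_prob[of "of_rat q"] unfolding F_def by simp
      with elim(2) q(2) show False by (meson not_le)
    qed
    ultimately show ?case
      unfolding support_interval_def lower_endpoint_def upper_endpoint_def
      by (auto intro!: Sup_least Inf_greatest)
  qed
qed

section \<open>The empirical cdf and its uniform deviation\<close>

lemma empirical_cdf_bounds: "empirical_cdf X n \<omega> x \<in> {0..1}"
proof -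
  have "card {t \<in> {1..n}. X (int t) \<omega> \<le> x} \<le> card {1..n}" by (intro card_mono) auto
  \<comment> \<open>This includes \<open>n = 0\<close>, where the quotient is 0 because division by
    zero gives 0.\<close>
  then show ?thesis by (auto simp: empirical_cdf_def divide_le_eq_1)
qed

text \<open>Suprema over the reals are meaningful for bounded sets only; this bound is what
  \<open>cSUP_upper\<close> and \<open>less_cSUP_iff\<close> ask for.\<close>

lemma bdd_above_empirical_cdf_diff:
  assumes "\<And>x. F x \<in> {0..1}"
  shows "bdd_above (range (\<lambda>x. \<bar>empirical_cdf X n \<omega> x - F x\<bar>))"
proof (rule bdd_aboveI2)
  fix x show "\<bar>empirical_cdf X n \<omega> x - F x\<bar> \<le> 1"
    using empirical_cdf_bounds[of X n \<omega> x] assms[of x] by auto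
qed

lemma measurable_empirical_cdf:
  assumes [measurable]: "\<And>t. X t \<in> borel_measurable M"
  shows "(\<lambda>\<omega>. empirical_cdf X n \<omega> x) \<in> borel_measurable M"
proof -
  have "empirical_cdf X n \<omega> x = (\<Sum>t=1..n. indicator {..x} (X (int t) \<omega>)) / real n" for \<omega>
    by (simp add: empirical_cdf_def indicator_def sum.If_cases Int_def)
  then show ?thesis by simp
qed

text \<open>Finitely many inputs leave an interval free of them immediately to the right of
  \<open>x\<close>.\<close>

lemma empirical_cdf_eventually_const:
  "\<forall>\<^sub>F y in at_right x. empirical_cdf X n \<omega> y = empirical_cdf X n \<omega> x"
proof -
  have "\<forall>\<^sub>F y in at_right x. \<forall>t\<in>{1..n}. X (int t) \<omega> \<le> y \<longleftrightarrow> X (int t) \<omega> \<le> x"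
  proof (intro eventually_ball_finite ballI)
    fix t
    show "\<forall>\<^sub>F y in at_right x. X (int t) \<omega> \<le> y \<longleftrightarrow> X (int t) \<omega> \<le> x"
    proof (cases "X (int t) \<omega> \<le> x")
      case True
      then show ?thesis
        using eventually_at_right_less[of x] by (auto elim!: eventually_mono)
    next
      case False
      then have "\<forall>\<^sub>F y in at_right x. y < X (int t) \<omega>"
        by (intro eventually_at_right_real[THEN eventually_mono]) auto
      with False show ?thesis by (auto elim!: eventually_mono)
    qed
  qed simp
  then show ?thesis
    by eventually_elim (auto simp: empirical_cdf_def intro!: arg_cong[of _ _ card])
qed

text \<open>The supremum is uncountable, but both cdfs are right-continuous, so a deviation above
  \<open>\<epsilon>\<close> at a real point persists at a rational point slightly to its
  right.\<close>

lemma sets_sup_empirical_cdf_diff_gt: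
  assumes X: "\<And>t. X t \<in> borel_measurable M"
    and F: "continuous_on UNIV F" "\<And>x. F x \<in> {0..1}"
  shows "{\<omega> \<in> space M. \<bar>(SUP x. \<bar>empirical_cdf X n \<omega> x - F x\<bar>) - 0\<bar> > \<epsilon>} \<in> sets M"
proof -
  let ?d = "\<lambda>\<omega> x. \<bar>empirical_cdf X n \<omega> x - F x\<bar>"
  have [measurable]: "(\<lambda>\<omega>. empirical_cdf X n \<omega> x) \<in> borel_measurable M" for x
    by (rule measurable_empirical_cdf[OF X])
  have bdd: "bdd_above (range (?d \<omega>))" for \<omega>
    by (rule bdd_above_empirical_cdf_diff[OF F(2)])
  have "0 \<le> (SUP x. ?d \<omega> x)" for \<omega>
    by (rule cSUP_upper2[OF bdd, of 0]) auto
  then have "\<bar>(SUP x. ?d \<omega> x) - 0\<bar> > \<epsilon> \<longleftrightarrow> (\<exists>x. ?d \<omega> x > \<epsilon>)" for \<omega>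
    using less_cSUP_iff[OF _ bdd] by simp
  moreover have "(\<exists>x. ?d \<omega> x > \<epsilon>) \<longleftrightarrow> (\<exists>q::rat. ?d \<omega> (of_rat q) > \<epsilon>)" for \<omega>
  proof
    assume "\<exists>x. ?d \<omega> x > \<epsilon>"
    then obtain x where x: "?d \<omega> x > \<epsilon>" ..
    have "isCont F x" using F(1) by (simp add: continuous_on_eq_continuous_at)
    then have "(F \<longlongrightarrow> F x) (at_right x)"
      unfolding isCont_def by (rule tendsto_mono[OF at_le, rotated]) simp
    then have "((\<lambda>y. \<bar>empirical_cdf X n \<omega> x - F y\<bar>) \<longlongrightarrow> ?d \<omega> x) (at_right x)"
      by (intro tendsto_intros)
    then have "\<forall>\<^sub>F y in at_right x. \<bar>empirical_cdf X n \<omega> x - F y\<bar> > \<epsilon>"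
      using x by (rule order_tendstoD(1))
    with empirical_cdf_eventually_const[of X n \<omega> x]
    have "\<forall>\<^sub>F y in at_right x. ?d \<omega> y > \<epsilon>" by eventually_elim simp
    then obtain b where "b > x" "\<And>y. x < y \<Longrightarrow> y < b \<Longrightarrow> ?d \<omega> y > \<epsilon>"
      by (auto simp: eventually_at_right_field)
    then show "\<exists>q::rat. ?d \<omega> (of_rat q) > \<epsilon>"
      using of_rat_dense[of x b] by blast
  qed blast
  ultimately have "{\<omega> \<in> space M. \<bar>(SUP x. ?d \<omega> x) - 0\<bar> > \<epsilon>}
      = {\<omega> \<in> space M. \<exists>q::rat. ?d \<omega> (of_rat q) > \<epsilon>}" by simp
  also have "\<dots> \<in> sets M" by measurable
  finally show ?thesis .
qed

text \<open>Turns an increase of the empirical cdf over a grid cell into an input in that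
  cell.\<close>

lemma empirical_cdf_less_imp_sample:
  assumes "empirical_cdf X n \<omega> u < empirical_cdf X n \<omega> v"
  obtains t where "t \<in> {1..n}" "u < X (int t) \<omega>" "X (int t) \<omega> \<le> v"
proof -
  have "\<not> {t \<in> {1..n}. X (int t) \<omega> \<le> v} \<subseteq> {t \<in> {1..n}. X (int t) \<omega> \<le> u}"
  proof
    assume "{t \<in> {1..n}. X (int t) \<omega> \<le> v} \<subseteq> {t \<in> {1..n}. X (int t) \<omega> \<le> u}"
    then have "card {t \<in> {1..n}. X (int t) \<omega> \<le> v} \<le> card {t \<in> {1..n}. X (int t) \<omega> \<le> u}"
      by (intro card_mono) auto
    then have "empirical_cdf X n \<omega> v \<le> empirical_cdf X n \<omega> u"
      unfolding empirical_cdf_def by (intro divide_right_mono) auto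
    with assms show False by simp
  qed
  then show ?thesis using that by force
qed

section \<open>Order statistics and concomitants\<close>

lemma order_stat_image:
  "(\<lambda>i. order_stat X i n \<omega>) ` {1..n} = (\<lambda>t. X (int t) \<omega>) ` {1..n}"
proof -
  let ?l = "sort (map (\<lambda>t. X (int t) \<omega>) [1..<Suc n])"
  have len: "length ?l = n" by simp
  have "(\<lambda>i. order_stat X i n \<omega>) ` {1..n} = (\<lambda>i. ?l ! i) ` {..<n}"
  proof (intro equalityI image_subsetI)
    fix i assume "i \<in> {1..n}"
    then show "order_stat X i n \<omega> \<in> (\<lambda>i. ?l ! i) ` {..<n}"
      by (auto simp: order_stat_def simp del: upt_Suc)
  next
    fix i assume "i \<in> {..<n}"
    then show "?l ! i \<in> (\<lambda>i. order_stat X i n \<omega>) ` {1..n}"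
      \<comment> \<open>The witness is \<open>Suc i\<close> because \<open>order_stat\<close> reads
        list position \<open>i - 1\<close>.\<close>
      by (intro image_eqI[of _ _ "Suc i"]) (auto simp: order_stat_def simp del: upt_Suc)
  qed
  also have "\<dots> = set ?l" using len by (auto simp: set_conv_nth simp del: upt_Suc)
  also have "\<dots> = (\<lambda>t. X (int t) \<omega>) ` {1..n}" by (simp add: atLeastLessThanSuc_atLeastAtMost del: upt_Suc)
  finally show ?thesis .
qed

lemma mono_on_order_stat: "mono_on {1..n} (\<lambda>i. order_stat X i n \<omega>)"
  unfolding order_stat_def by (intro mono_onI sorted_nth_mono) auto

text \<open>Distinctness of the inputs lets the defining sum select exactly one index.\<close>

lemma concomitant_baseline_output:
  assumes "inj (\<lambda>t. X t \<omega>)" and "i \<in> {1..n}"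
  shows "concomitant X (baseline_output h X) i n \<omega> = h (order_stat X i n \<omega>)"
proof -
  obtain s where s: "s \<in> {1..n}" "order_stat X i n \<omega> = X (int s) \<omega>"
    using order_stat_image[of X n \<omega>] assms(2) by blast
  have "X (int t) \<omega> = order_stat X i n \<omega> \<longleftrightarrow> t = s" for t
    using injD[OF assms(1), of "int t" "int s"] s(2) by auto
  then have "concomitant X (baseline_output h X) i n \<omega>
      = (\<Sum>t=1..n. if t = s then baseline_output h X (int t) \<omega> else 0)"
    unfolding concomitant_def by (intro sum.cong) auto
  with s show ?thesis by (simp add: baseline_output_def)
qed

section \<open>Reduction to the interval and stability of ratios\<close>

text \<open>Between \<open>x\<close> and the nearest point of \<open>{a..b}\<close> the derivative
  vanishes almost everywhere, so its integral is zero.\<close>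

lemma absolutely_continuous_clamp:
  assumes "absolutely_continuous_with_deriv h g S" and "{a..b} \<subseteq> S" "a \<le> b"
    and g0: "\<And>x. x \<in> S - {a..b} \<Longrightarrow> g x = 0"
    and S: "\<And>u v. u \<in> S \<Longrightarrow> v \<in> S \<Longrightarrow> {u..v} \<subseteq> S" and "x \<in> S"
  shows "h x = h (max a (min b x))"
proof -
  have zero: "h v = h u" if uv: "u \<in> S" "v \<in> S" "u \<le> v" "{u<..<v} \<inter> {a..b} = {}" for u v
  proof -
    \<comment> \<open>Only almost everywhere: one end of the stretch is \<open>a\<close> or
      \<open>b\<close>, where \<open>g\<close> may be nonzero.\<close>
    have "AE t in lborel. indicator {u..v} t *\<^sub>R g t = 0"
      using AE_lborel_singleton[of u] AE_lborel_singleton[of v]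
    proof eventually_elim
      case (elim t)
      have "g t = 0" if "t \<in> {u..v}"
      proof -
        have "t \<in> {u<..<v}" using that elim by auto
        then show ?thesis using uv(4) S[OF uv(1,2)] that by (intro g0) blast
      qed
      then show ?case by (simp add: indicator_def)
    qed
    then have "(LINT t:{u..v}|lborel. g t) = 0"
      unfolding set_lebesgue_integral_def by (rule integral_eq_zero_AE)
    moreover have "h v - h u = (LINT t:{u..v}|lborel. g t)"
      using assms(1) uv unfolding absolutely_continuous_with_deriv_def by blast
    ultimately show ?thesis by simp
  qed
  have "a \<in> S" "b \<in> S" using assms(2,3) by auto
  consider "x < a" | "x \<in> {a..b}" | "b < x" by fastforce
  then show ?thesis
  proof cases
    case 1
    then show ?thesis using zero[of x a] \<open>a \<in> S\<close> assms(3,6) by force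
  next
    case 3
    then show ?thesis using zero[of b x] \<open>b \<in> S\<close> assms(3,6) by force
  qed auto
qed

text \<open>The bound \<open>e \<le> J / 2\<close> keeps \<open>D\<close> above
  \<open>J / 2\<close>. In the constant 4, one factor 2 comes from this and the other from the two
  errors, with \<open>P \<le> J\<close>.\<close>

lemma ratio_close:
  fixes P J N D e :: real
  assumes "0 \<le> P" "P \<le> J" "J > 0" "e \<le> J / 2" "\<bar>N - P\<bar> \<le> e" "\<bar>D - J\<bar> \<le> e"
  shows "D > 0" "\<bar>N / D - P / J\<bar> \<le> 4 * e / J"
proof -
  have D: "D \<ge> J / 2" using assms by linarith
  then show "D > 0" using assms(3) by linarith
  have e: "e \<ge> 0" using assms(5) by linarith
  have "N / D - P / J = ((N - P) * J - P * (D - J)) / (D * J)"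
    using \<open>D > 0\<close> assms(3) by (simp add: field_simps)
  also have "\<bar>\<dots>\<bar> = \<bar>(N - P) * J - P * (D - J)\<bar> / (D * J)"
    using \<open>D > 0\<close> assms(3) by (simp add: abs_mult)
  also have "\<dots> \<le> (2 * e * J) / (J / 2 * J)"
  proof (rule frac_le)
    have "\<bar>(N - P) * J\<bar> \<le> e * J" "\<bar>P * (D - J)\<bar> \<le> J * e"
      unfolding abs_mult using assms e by (auto intro!: mult_mono)
    then have "\<bar>(N - P) * J - P * (D - J)\<bar> \<le> e * J + J * e" by linarith
    then show "\<bar>(N - P) * J - P * (D - J)\<bar> \<le> 2 * e * J" by (simp add: mult.commute mult.left_commute)
  qed (use D assms(3) e in \<open>auto intro: mult_right_mono\<close>)
  also have "\<dots> = 4 * e / J" using assms(3) by (simp add: field_simps)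
  finally show "\<bar>N / D - P / J\<bar> \<le> 4 * e / J" .
qed

section \<open>Convergence of the index in probability\<close>

theorem corollary7p1:
  fixes M :: "'a measure"
    and X :: "int \<Rightarrow> 'a \<Rightarrow> real"
    and F h\<^sub>0 h\<^sub>0' :: "real \<Rightarrow> real"
    and a b p c :: real
  assumes "prob_space M"
    and "\<And>t. X t \<in> borel_measurable M"
    and "\<And>t. cdf (distr M borel (X t)) = F"
    and "AE \<omega> in M. inj (\<lambda>t. X t \<omega>)"
    and "\<And>t. baseline_output h\<^sub>0 X t \<in> borel_measurable M"
    and "strictly_stationary M X"
    and "temperately_dependent M X F"
    and "glivenko_cantelli M X F"
    and "p > 2"
    and "\<And>t. integrable M (\<lambda>\<omega>. \<bar>X t \<omega>\<bar> powr p)"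
    and "continuous_on UNIV F"
    and "continuous_on {0<..<1} (quantile F)"
    and "absolutely_continuous_with_deriv h\<^sub>0 h\<^sub>0' (support_interval F)"
    and "{a..b} \<subseteq> support_interval F"
    and "continuous_on {a..b} h\<^sub>0'"
    and "\<And>x. x \<in> support_interval F - {a..b} \<Longrightarrow> h\<^sub>0' x = 0"
    and "(LINT x:{a..b}|lborel. \<bar>h\<^sub>0' x\<bar>) > 0"
  shows "tendsto_in_prob M (I_index c X (baseline_output h\<^sub>0 X))
           ((LINT x:{a..b}|lborel. max (h\<^sub>0' x) 0) / (LINT x:{a..b}|lborel. \<bar>h\<^sub>0' x\<bar>))"
proof -
  interpret prob_space M by fact
  interpret D: real_distribution "distr M borel (X 0)"
    using real_distribution_distr assms(2) by simp
  let ?S = "support_interval F"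
  have mono: "mono F" 
    using D.cdf_nondecreasing by (auto intro!: monoI simp flip: assms(3)[of 0])
  have range: "F x \<in> {0..1}" for x
    using D.cdf_nonneg D.cdf_bounded_prob by (simp flip: assms(3)[of 0])
  have top: "(F \<longlongrightarrow> 1) at_top" and bot: "(F \<longlongrightarrow> 0) at_bot"
    using D.cdf_lim_at_top_prob D.cdf_lim_at_bot by (simp_all add: assms(3))
  have less: "F u < F v" if "u \<in> ?S" "v \<in> ?S" "u < v" for u v
    using continuous_quantile_imp_less[OF mono top bot range assms(12) that] .
  have S: "{u..v} \<subseteq> ?S" if "u \<in> ?S" "v \<in> ?S" for u v
  proof
    fix x assume "x \<in> {u..v}"
    then have "ereal u \<le> ereal x" "ereal x \<le> ereal v" by auto
    then show "x \<in> ?S" using that unfolding support_interval_def by (blast intro: order_trans)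
  qed
  have "AE \<omega> in M. \<forall>t. X t \<omega> \<in> ?S"
    using AE_in_support_interval[OF assms(1,2)] by (subst AE_all_countable) (simp add: assms(3))
  with assms(4) have good: "AE \<omega> in M. inj (\<lambda>t. X t \<omega>) \<and> (\<forall>t. X t \<omega> \<in> ?S)"
    by eventually_elim simp

  define P where "P = (LINT x:{a..b}|lborel. max (h\<^sub>0' x) 0)"
  define J where "J = (LINT x:{a..b}|lborel. \<bar>h\<^sub>0' x\<bar>)"
  have "J > 0" using assms(17) by (simp add: J_def)
  \<comment> \<open>On an empty or one-point interval the integral \<open>J\<close> would be
    zero.\<close>
  have "a < b"
  proof (rule ccontr)
    assume "\<not> a < b"
    then consider "{a..b} = {}" | "a = b" by fastforce
    moreover have "J = integral {a..b} (\<lambda>x. \<bar>h\<^sub>0' x\<bar>)"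
      unfolding J_def using assms(15)
      by (intro set_borel_integral_eq_integral borel_integrable_atLeastAtMost' continuous_intros)
    ultimately have "J = 0" by cases (simp_all del: atLeastatMost_empty_iff)
    with \<open>J > 0\<close> show False by simp
  qed
  then have ab: "a \<in> ?S" "b \<in> ?S" using assms(14) by auto
  have PJ: "0 \<le> P" "P \<le> J"
  proof -
    show "0 \<le> P" unfolding P_def set_lebesgue_integral_def by (intro Bochner_Integration.integral_nonneg) simp
    show "P \<le> J" unfolding P_def J_def
      using assms(15) by (intro set_integral_mono borel_integrable_atLeastAtMost' continuous_intros) auto
  qed
  have h: "h\<^sub>0 v - h\<^sub>0 u = (LINT x:{u..v}|lborel. h\<^sub>0' x)" if "a \<le> u" "u \<le> v" "v \<le> b" for u v
    using assms(13,14) that unfolding absolutely_continuous_with_deriv_def by (auto simp: subset_iff)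
  have clamp: "h\<^sub>0 x = h\<^sub>0 (clamp_Icc a b x)" if "x \<in> ?S" for x
    using absolutely_continuous_clamp[OF assms(13,14) _ assms(16) S that] \<open>a < b\<close> by simp

  have "(\<lambda>n. \<P>(\<omega> in M. \<bar>I_index c X (baseline_output h\<^sub>0 X) n \<omega> - P / J\<bar> > \<epsilon>)) \<longlonglongrightarrow> 0"
    if "\<epsilon> > 0" for \<epsilon>
  proof -
    \<comment> \<open>\<open>J / 2\<close> keeps the denominator positive, and
      \<open>\<epsilon> * J / 4\<close> makes the bound of \<open>ratio_close\<close> at most
      \<open>\<epsilon>\<close>.\<close>
    define e where "e = min (J / 2) (\<epsilon> * J / 4)"
    have e: "e > 0" "e \<le> J / 2" "4 * e / J \<le> \<epsilon>"
      using that \<open>J > 0\<close> by (auto simp: e_def field_simps)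
    define hits where "hits m n y \<longleftrightarrow> (\<forall>j<m. \<exists>i\<in>{1..n}. a + j * ((b - a) / m) < y i
        \<and> y i \<le> a + Suc j * ((b - a) / m))" for m n :: nat and y :: "nat \<Rightarrow> real"
    define close where "close \<psi> n y \<longleftrightarrow> 
        \<bar>(\<Sum>i=2..n. \<psi> (h\<^sub>0 (clamp_Icc a b (y i)) - h\<^sub>0 (clamp_Icc a b (y (i - 1)))))
          - (LINT x:{a..b}|lborel. \<psi> (h\<^sub>0' x))\<bar> \<le> e"
      for \<psi> :: "real \<Rightarrow> real" and n :: nat and y :: "nat \<Rightarrow> real"
    have ev: "\<forall>\<^sub>F m in sequentially. \<forall>n y. mono_on {1..n} y \<longrightarrow> hits m n y \<longrightarrow> close \<psi> n y"
      if "\<And>c x. c \<ge> 0 \<Longrightarrow> \<psi> (x * c) = \<psi> x * c" "\<And>x y. \<bar>\<psi> x - \<psi> y\<bar> \<le> \<bar>x - y\<bar>" for \<psi>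
      using sum_increments_approx[of a b h\<^sub>0' h\<^sub>0 \<psi> e, OF \<open>a < b\<close> assms(15) h that \<open>e > 0\<close>]
      unfolding hits_def close_def .
    have hom: "max (x * c) 0 = max x 0 * c" if "c \<ge> 0" for x c :: real
      using max_mult_distrib_right[of x 0 c] that by simp
    have "\<forall>\<^sub>F m in sequentially. \<forall>n y. mono_on {1..n} y \<longrightarrow> hits m n y \<longrightarrow> close (\<lambda>x. max x 0) n y"
      by (rule ev) (auto simp: hom)
    moreover have "\<forall>\<^sub>F m in sequentially. \<forall>n y. mono_on {1..n} y \<longrightarrow> hits m n y \<longrightarrow> close abs n y"
      by (rule ev) (auto simp: abs_mult)
    ultimately have "\<forall>\<^sub>F m in sequentially. m > 0 \<and> (\<forall>n y. mono_on {1..n} y \<longrightarrow> hits m n y \<longrightarrow>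
        close (\<lambda>x. max x 0) n y \<and> close abs n y)"
      using eventually_gt_at_top[of 0] by eventually_elim simp
    \<comment> \<open>One grid serves both sums and is fixed before \<open>n\<close> grows.\<close>
    then obtain m where m: "m > 0"
      "\<And>n y. mono_on {1..n} y \<Longrightarrow> hits m n y \<Longrightarrow> close (\<lambda>x. max x 0) n y \<and> close abs n y"
      using eventually_happens'[OF sequentially_bot] by blast
    define g where "g j = a + real j * ((b - a) / m)" for j
    have gS: "g j \<in> ?S" if "j \<le> m" for j
    proof -
      have "real j * ((b - a) / m) \<le> real m * ((b - a) / m)"
        using that \<open>a < b\<close> by (intro mult_right_mono) auto
      also have "\<dots> = b - a" using \<open>m > 0\<close> by simp
      finally have "g j \<in> {a..b}" using \<open>a < b\<close> by (simp add: g_def)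
      with assms(14) show ?thesis by blast
    qed
    have Fg: "F (g j) < F (g (Suc j))" if "j < m" for j
      using that gS[of j] gS[of "Suc j"] \<open>a < b\<close> \<open>m > 0\<close> by (intro less) (auto simp: g_def divide_strict_right_mono)
    \<comment> \<open>A third of the smallest cell probability: deviations of at most
      \<open>\<kappa>\<close> at both ends of a cell still leave the empirical cdf an increase of at
      least \<open>\<kappa>\<close> over it.\<close>
    define \<kappa> where "\<kappa> = Min ((\<lambda>j. F (g (Suc j)) - F (g j)) ` {..<m}) / 3"
    have "0 < Min ((\<lambda>j. F (g (Suc j)) - F (g j)) ` {..<m})"
      using Fg \<open>m > 0\<close> by (subst Min_gr_iff) (auto simp: lessThan_empty_iff)
    then have "\<kappa> > 0" by (simp add: \<kappa>_def)
    have \<kappa>: "3 * \<kappa> \<le> F (g (Suc j)) - F (g j)" if "j < m" for j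
      using that unfolding \<kappa>_def by (auto intro!: Min_le)
    let ?A = "\<lambda>n. {\<omega> \<in> space M. \<bar>(SUP x. \<bar>empirical_cdf X n \<omega> x - F x\<bar>) - 0\<bar> > \<kappa>}"
    let ?B = "\<lambda>n. {\<omega> \<in> space M. \<bar>I_index c X (baseline_output h\<^sub>0 X) n \<omega> - P / J\<bar> > \<epsilon>}"
    have lim: "(\<lambda>n. prob (?A n)) \<longlonglongrightarrow> 0"
      using assms(8) \<open>\<kappa> > 0\<close> unfolding glivenko_cantelli_def tendsto_in_prob_def by blast
    \<comment> \<open>Almost surely, a uniform deviation of at most \<open>\<kappa>\<close> puts the
      index within \<open>\<epsilon>\<close> of its limit, so \<open>?B n\<close> lies in
      \<open>?A n\<close> up to a null set.\<close>
    have le: "prob (?B n) \<le> prob (?A n)" for n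
    proof (rule finite_measure_mono_AE)
      show "?A n \<in> sets M" using sets_sup_empirical_cdf_diff_gt assms(2,11) range by blast
      show "AE \<omega> in M. \<omega> \<in> ?B n \<longrightarrow> \<omega> \<in> ?A n"
      proof (rule eventually_mono[OF good], intro impI, rule ccontr)
        fix \<omega>
        assume inj: "inj (\<lambda>t. X t \<omega>) \<and> (\<forall>t. X t \<omega> \<in> ?S)"
          and B: "\<omega> \<in> ?B n" and A: "\<omega> \<notin> ?A n"
        define y where "y i = order_stat X i n \<omega>" for i
        have img: "y ` {1..n} = (\<lambda>t. X (int t) \<omega>) ` {1..n}"
          unfolding y_def by (rule order_stat_image)
        have diff: "\<bar>empirical_cdf X n \<omega> x - F x\<bar> \<le> \<kappa>" for x
        proof -
          have "\<bar>empirical_cdf X n \<omega> x - F x\<bar> \<le> (SUP x. \<bar>empirical_cdf X n \<omega> x - F x\<bar>)"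
            by (intro cSUP_upper bdd_above_empirical_cdf_diff range) auto
          also have "\<dots> \<le> \<kappa>" using A B by auto
          finally show ?thesis .
        qed
        have "hits m n y"
          unfolding hits_def g_def[symmetric]
        proof (intro allI impI)
          fix j assume "j < m"
          have "empirical_cdf X n \<omega> (g j) < empirical_cdf X n \<omega> (g (Suc j))"
            using \<kappa>[OF \<open>j < m\<close>] diff[of "g j"] diff[of "g (Suc j)"] \<open>\<kappa> > 0\<close> by linarith
          then obtain t where t: "t \<in> {1..n}" "g j < X (int t) \<omega>" "X (int t) \<omega> \<le> g (Suc j)"
            by (rule empirical_cdf_less_imp_sample)
          then obtain i where "i \<in> {1..n}" "y i = X (int t) \<omega>"
            using img by (metis imageE imageI)
          with t show "\<exists>i\<in>{1..n}. g j < y i \<and> y i \<le> g (Suc j)"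
            by (intro bexI[of _ i]) simp_all
        qed
        moreover have "mono_on {1..n} y" unfolding y_def by (rule mono_on_order_stat)
        ultimately have cl: "close (\<lambda>x. max x 0) n y" "close abs n y" using m(2) by auto
        \<comment> \<open>Distinctness identifies the concomitant with
          \<open>h\<^sub>0 (y i)\<close>; membership in the support then allows projection onto
          \<open>{a..b}\<close>.\<close>
        have conc: "concomitant X (baseline_output h\<^sub>0 X) i n \<omega> = h\<^sub>0 (clamp_Icc a b (y i))"
          if "i \<in> {1..n}" for i
        proof -
          have "y i \<in> y ` {1..n}" using that by (rule imageI)
          then have "y i \<in> ?S" unfolding img using inj by auto
          then have "h\<^sub>0 (y i) = h\<^sub>0 (clamp_Icc a b (y i))" by (rule clamp)
          moreover have "concomitant X (baseline_output h\<^sub>0 X) i n \<omega> = h\<^sub>0 (y i)"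
            unfolding y_def using inj that by (intro concomitant_baseline_output) auto
          ultimately show ?thesis by (rule trans[rotated])
        qed
        define inc where "inc i = h\<^sub>0 (clamp_Icc a b (y i)) - h\<^sub>0 (clamp_Icc a b (y (i - 1)))" for i
        have sums: "(\<Sum>i=2..n. \<psi> (concomitant X (baseline_output h\<^sub>0 X) i n \<omega>
            - concomitant X (baseline_output h\<^sub>0 X) (i - 1) n \<omega>)) = (\<Sum>i=2..n. \<psi> (inc i))"
          for \<psi> :: "real \<Rightarrow> real"
        proof (intro sum.cong refl)
          fix i assume "i \<in> {2..n}"
          then have "i \<in> {1..n}" "i - 1 \<in> {1..n}" by auto
          then show "\<psi> (concomitant X (baseline_output h\<^sub>0 X) i n \<omega>
              - concomitant X (baseline_output h\<^sub>0 X) (i - 1) n \<omega>) = \<psi> (inc i)"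
            by (simp only: conc inc_def)
        qed
        have N: "\<bar>(\<Sum>i=2..n. max (inc i) 0) - P\<bar> \<le> e" and D: "\<bar>(\<Sum>i=2..n. \<bar>inc i\<bar>) - J\<bar> \<le> e"
          using cl unfolding close_def inc_def P_def J_def by auto
        note ratio = ratio_close[OF PJ \<open>J > 0\<close> e(2) N D]
        \<comment> \<open>By \<open>ratio(1)\<close> the denominator is positive, so the default
          value \<open>c\<close> does not occur here.\<close>
        have "I_index c X (baseline_output h\<^sub>0 X) n \<omega> = (\<Sum>i=2..n. max (inc i) 0) / (\<Sum>i=2..n. \<bar>inc i\<bar>)"
          unfolding I_index_def Let_def sums[of "\<lambda>x. max x 0"] sums[of abs] using ratio(1) by simp
        with ratio(2) e(3) B show False by simp
      qed
    qed
    show ?thesis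
      by (rule tendsto_sandwich[OF always_eventually always_eventually tendsto_const lim])
        (rule allI, rule measure_nonneg, rule allI, rule le)
  qed
  then show ?thesis
    unfolding tendsto_in_prob_def P_def J_def by blast
qed

end
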